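(* There exist absolute constants $c>0$, $C>0$ such that, for any integers $s,d$ satisfying $1\le s\le d$ and any $\sigma>0$, $$\sup_{\theta\in B_0(s)} \mathbf E_\theta\big(\hat L - L(\theta)\big)^2 \le C\, \sigma^2 s^2\log(1+d/s^2),$$ and $$\inf_{\hat T}\sup_{\theta\in B_0(s)} \mathbf E_\theta\big(\hat T - L(\theta)\big)^2 \ge c\, \sigma^2 s^2\log(1+d/s^2),$$ where $\inf_{\hat T}$ is the infimum over all estimators.
   Context: Model: one observes $y_j=\theta_j+\sigma\xi_j$, $j=1,\dots,d$, where $\theta=(\theta_1,\dots,\theta_d)\in\mathbb R^d$ is unknown, $\xi_1,\dots,\xi_d$ are i.i.d. standard normal and $\sigma>0$. $\mathbf P_\theta$ is the law of $(y_1,\dots,y_d)$ and $\mathbf E_\theta$ the corresponding expectation. An estimator is a measurable real-valued function of $(y_1,\dots,y_d)$ (it may depend on known parameters such as $d,s,\sigma$). $L(\theta)=\sum_{i=1}^d\theta_i$; $\|\theta\|_0$ is the number of non-zero components of $\theta$; $B_0(s)=\{\theta\in\mathbb R^d:\|\theta\|_0\le s\}$. The estimator $\hat L$ is $$\hat L=\begin{cases}\sum_{j=1}^d y_j\,\mathbf 1_{\{|y_j|>\sigma\sqrt{2\log(1+d/s^2)}\}} & \text{if } s<\sqrt d,\\ \sum_{j=1}^d y_j & \text{if } s\ge\sqrt d.\end{cases}$$ *)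

theory Defs
  imports "HOL-Probability.Probability"
begin

text \<open>
  Since \<open>d\<close> is quantified inside the theorem, a vector of \<open>\<real>\<^sup>d\<close> is an extensional function on
  \<open>{1..d}\<close> (it is \<open>undefined\<close> elsewhere), that is, a point of the product space \<open>Rd d\<close>.
\<close>

definition Rd :: "nat \<Rightarrow> (nat \<Rightarrow> real) measure" where
  "Rd d = PiM {1..d} (\<lambda>_. borel)"

definition obs_law :: "real \<Rightarrow> nat \<Rightarrow> (nat \<Rightarrow> real) \<Rightarrow> (nat \<Rightarrow> real) measure" where
  "obs_law \<sigma> d \<theta> =
     distr (PiM {1..d} (\<lambda>_. density lborel std_normal_density)) (Rd d)
       (\<lambda>\<xi>. \<lambda>j\<in>{1..d}. \<theta> j + \<sigma> * \<xi> j)"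

definition lin :: "nat \<Rightarrow> (nat \<Rightarrow> real) \<Rightarrow> real" where
  "lin d \<theta> = (\<Sum>j=1..d. \<theta> j)"

definition l0_norm :: "nat \<Rightarrow> (nat \<Rightarrow> real) \<Rightarrow> nat" where
  "l0_norm d \<theta> = card {j \<in> {1..d}. \<theta> j \<noteq> 0}"

definition B0 :: "nat \<Rightarrow> nat \<Rightarrow> (nat \<Rightarrow> real) set" where
  "B0 d s = {\<theta> \<in> space (Rd d). l0_norm d \<theta> \<le> s}"

definition estimators :: "nat \<Rightarrow> ((nat \<Rightarrow> real) \<Rightarrow> real) set" where
  "estimators d = borel_measurable (Rd d)"

text \<open>
  The risk is an \<open>ennreal\<close>-valued integral: an estimator may have infinite mean squared error,
  for which the Bochner integral would return 0.
\<close>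

definition mse :: "real \<Rightarrow> nat \<Rightarrow> ((nat \<Rightarrow> real) \<Rightarrow> real) \<Rightarrow> (nat \<Rightarrow> real) \<Rightarrow> ennreal" where
  "mse \<sigma> d T \<theta> = (\<integral>\<^sup>+ y. ennreal ((T y - lin d \<theta>)\<^sup>2) \<partial>obs_law \<sigma> d \<theta>)"

definition L_hat :: "real \<Rightarrow> nat \<Rightarrow> nat \<Rightarrow> (nat \<Rightarrow> real) \<Rightarrow> real" where
  "L_hat \<sigma> d s y =
     (if real s < sqrt (real d)
      then \<Sum>j=1..d. y j *
             indicat_real {x. \<bar>x\<bar> > \<sigma> * sqrt (2 * ln (1 + real d / (real s)\<^sup>2))} (y j)
      else \<Sum>j=1..d. y j)"

lemma obs_map_measurable:
  "(\<lambda>\<xi>. \<lambda>j\<in>{1..d}. \<theta> j + \<sigma> * \<xi> j)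
     \<in> PiM {1..d} (\<lambda>_. density lborel std_normal_density) \<rightarrow>\<^sub>M Rd d"
  unfolding Rd_def by measurable

lemma prob_space_obs_law: "prob_space (obs_law \<sigma> d \<theta>)"
  unfolding obs_law_def
  by (intro prob_space.prob_space_distr prob_space_PiM prob_space_normal_density obs_map_measurable)
     simp

lemma L_hat_in_estimators: "L_hat \<sigma> d s \<in> estimators d"
  unfolding estimators_def Rd_def L_hat_def[abs_def] by measurable

end

theory Submission
  imports Defs
begin

text \<open>
  Upper bound for \<open>s < \<surd>d\<close>, at level \<open>\<tau> = \<surd>(2 log (1 + d/s\<^sup>2))\<close> in noise units: on the support of
  \<open>\<theta>\<close> each summand errs by at most \<open>\<sigma> (\<bar>\<xi>\<^sub>j\<bar> + \<tau>)\<close>; off the support the errors are independent and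
  centred, and each has variance at most \<open>2 \<sigma>\<^sup>2 exp (- \<tau>\<^sup>2 / 2) (1 + \<tau>\<^sup>2)\<close>, where
  \<open>d exp (- \<tau>\<^sup>2 / 2) \<le> s\<^sup>2\<close>.

  Lower bound: compare \<open>\<theta> = 0\<close> with a uniform mixture of \<open>s\<close>-sparse vectors having entries
  \<open>\<sigma> \<surd>(log (1 + d/s\<^sup>2))\<close>, so that \<open>L\<close> is constant on the mixture. If \<open>f\<close> is the likelihood ratio of the
  mixture, then \<open>T\<^sup>2 + (T - L)\<^sup>2 f \<ge> L\<^sup>2 f / (1 + f)\<close> for every value \<open>T\<close>, and the expectation of the right
  side under \<open>\<theta> = 0\<close> is at least \<open>L\<^sup>2 / (1 + E f\<^sup>2)\<close>, where \<open>E f\<^sup>2\<close> is bounded by a constant.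
\<close>

section \<open>Gaussian shifts\<close>

abbreviation std_normal :: "real measure" where
  "std_normal \<equiv> density lborel (\<lambda>x. ennreal (std_normal_density x))"

interpretation std_normal: prob_space std_normal
  by (rule prob_space_normal_density) simp

interpretation std_normals: product_prob_space "\<lambda>_. std_normal" I for I :: "'i set"
  by (rule product_prob_spaceI) (rule std_normal.prob_space_axioms)

text \<open>The density of the normal law with mean \<open>\<mu>\<close> and variance 1 relative to
  the standard normal law.\<close>

definition tilt :: "real \<Rightarrow> real \<Rightarrow> real" where
  "tilt \<mu> x = exp (\<mu> * x - \<mu>\<^sup>2 / 2)"

lemma tilt_pos: "0 < tilt \<mu> x"
  by (simp add: tilt_def)

lemma tilt_measurable [measurable]: "tilt \<mu> \<in> borel_measurable borel"
  unfolding tilt_def[abs_def] by measurable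

lemma nn_integral_std_normal:
  "f \<in> borel_measurable borel \<Longrightarrow>
    (\<integral>\<^sup>+x. f x \<partial>std_normal) = (\<integral>\<^sup>+x. ennreal (std_normal_density x) * f x \<partial>lborel)"
  by (subst nn_integral_density) auto

text \<open>Translation invariance of Lebesgue measure moves the shift from the argument to the
  density, and the quotient of the shifted density by the original one is
  \<open>tilt \<mu>\<close>.\<close>

lemma nn_integral_std_normal_shift:
  assumes [measurable]: "f \<in> borel_measurable borel"
  shows "(\<integral>\<^sup>+x. f (\<mu> + x) \<partial>std_normal) = (\<integral>\<^sup>+x. f x * ennreal (tilt \<mu> x) \<partial>std_normal)"
proof -
  have dens: "std_normal_density (\<mu> + x) * tilt \<mu> (\<mu> + x) = std_normal_density x" for x
    by (simp add: std_normal_density_def tilt_def flip: exp_add)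
       (simp add: field_simps power2_eq_square)
  have "(\<integral>\<^sup>+x. f x * ennreal (tilt \<mu> x) \<partial>std_normal)
      = (\<integral>\<^sup>+x. ennreal (std_normal_density x) * (f x * ennreal (tilt \<mu> x)) \<partial>lborel)"
    by (rule nn_integral_std_normal) measurable
  also have "\<dots> = (\<integral>\<^sup>+x. ennreal (std_normal_density (\<mu> + x)) *
      (f (\<mu> + x) * ennreal (tilt \<mu> (\<mu> + x))) \<partial>lborel)"
    by (subst nn_integral_real_affine[where c=1 and t=\<mu>]) auto
  also have "\<dots> = (\<integral>\<^sup>+x. ennreal (std_normal_density x) * f (\<mu> + x) \<partial>lborel)"
  proof (rule nn_integral_cong)
    fix x
    have "ennreal (std_normal_density x)
        = ennreal (std_normal_density (\<mu> + x)) * ennreal (tilt \<mu> (\<mu> + x))"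
      by (simp only: dens[of x, symmetric] ennreal_mult normal_density_nonneg tilt_pos less_imp_le)
    then show "ennreal (std_normal_density (\<mu> + x)) * (f (\<mu> + x) * ennreal (tilt \<mu> (\<mu> + x)))
        = ennreal (std_normal_density x) * f (\<mu> + x)"
      by (simp only: mult_ac)
  qed
  also have "\<dots> = (\<integral>\<^sup>+x. f (\<mu> + x) \<partial>std_normal)"
    by (rule nn_integral_std_normal[symmetric]) measurable
  finally show ?thesis by simp
qed

lemma nn_integral_tilt: "(\<integral>\<^sup>+x. ennreal (tilt \<mu> x) \<partial>std_normal) = 1"
  using nn_integral_std_normal_shift[of "\<lambda>_. 1" \<mu>] std_normal.emeasure_space_1 by simp

text \<open>One factor is absorbed as a shift by \<open>\<nu>\<close>. The other one then reads
  \<open>exp (\<mu> * \<nu>) * tilt \<mu> x\<close>, where \<open>tilt \<mu>\<close> has mean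
  1.\<close>

lemma nn_integral_tilt_mult_tilt:
  "(\<integral>\<^sup>+x. ennreal (tilt \<mu> x) * ennreal (tilt \<nu> x) \<partial>std_normal) = ennreal (exp (\<mu> * \<nu>))"
proof -
  have "(\<integral>\<^sup>+x. ennreal (tilt \<mu> x) * ennreal (tilt \<nu> x) \<partial>std_normal)
      = (\<integral>\<^sup>+x. ennreal (tilt \<mu> (\<nu> + x)) \<partial>std_normal)"
    by (rule nn_integral_std_normal_shift[symmetric]) measurable
  also have "\<dots> = (\<integral>\<^sup>+x. ennreal (exp (\<mu> * \<nu>)) * ennreal (tilt \<mu> x) \<partial>std_normal)"
    by (intro nn_integral_cong)
       (simp add: tilt_def algebra_simps flip: ennreal_mult' exp_add)
  also have "\<dots> = ennreal (exp (\<mu> * \<nu>)) * (\<integral>\<^sup>+x. ennreal (tilt \<mu> x) \<partial>std_normal)"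
    by (rule nn_integral_cmult) measurable
  finally show ?thesis by (simp add: nn_integral_tilt)
qed

lemma nn_integral_std_normal_square: "(\<integral>\<^sup>+x. ennreal (x\<^sup>2) \<partial>std_normal) = 1"
proof -
  have "(\<integral>\<^sup>+x. ennreal (x\<^sup>2) \<partial>std_normal)
      = (\<integral>\<^sup>+x. ennreal (std_normal_density x * x\<^sup>2) \<partial>lborel)"
    by (subst nn_integral_std_normal) (auto simp: ennreal_mult')
  also have "\<dots> = 1"
    \<comment> \<open>The even moment of order 2 k is (2 k)! / (2^k k!), which is 1 at k =
      1.\<close>
    using has_bochner_integral_integral_eq[OF std_normal_moment_even[of 1]]
      integrable.intros[OF std_normal_moment_even[of 1]]
    by (subst nn_integral_eq_integral) auto
  finally show ?thesis .
qed

section \<open>Truncated normal variables\<close>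

text \<open>Thresholding in noise units, with the same strict inequality as in
  \<open>L_hat\<close>.\<close>

definition hard_thr :: "real \<Rightarrow> real \<Rightarrow> real" where
  "hard_thr t x = x * indicat_real {x. \<bar>x\<bar> > t} x"

lemma hard_thr_measurable [measurable]: "hard_thr t \<in> borel_measurable borel"
  unfolding hard_thr_def[abs_def] by measurable

lemma hard_thr_neg_level: "t < 0 \<Longrightarrow> hard_thr t x = x"
  by (simp add: hard_thr_def)

lemma hard_thr_square_le: "(hard_thr t x)\<^sup>2 \<le> x\<^sup>2"
  by (simp add: hard_thr_def indicator_def)

lemma integrable_std_normal_hard_thr_square: "integrable std_normal (\<lambda>x. (hard_thr t x)\<^sup>2)"
proof (rule Bochner_Integration.integrable_bound)
  show "integrable std_normal (\<lambda>x. x\<^sup>2)"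
    using nn_integral_std_normal_square by (auto intro!: integrableI_nonneg)
qed (auto intro!: AE_I2 hard_thr_square_le)

lemma integrable_std_normal_hard_thr: "integrable std_normal (hard_thr t)"
  by (rule std_normal.square_integrable_imp_integrable)
     (auto intro: integrable_std_normal_hard_thr_square)

text \<open>The density is even and thresholding is odd, so the reflection of \<open>x\<close> turns
  the integral into its own negative.\<close>

lemma integral_std_normal_hard_thr: "(\<integral>x. hard_thr t x \<partial>std_normal) = 0"
proof -
  have eq: "(\<integral>x. hard_thr t x \<partial>std_normal) = (\<integral>x. std_normal_density x * hard_thr t x \<partial>lborel)"
    by (subst integral_density) auto
  also have "\<dots> = (\<integral>x. std_normal_density (-x) * hard_thr t (-x) \<partial>lborel)"
    by (subst lborel_integral_real_affine[where c="-1" and t=0]) auto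
  also have "\<dots> = - (\<integral>x. std_normal_density x * hard_thr t x \<partial>lborel)"
    by (subst Bochner_Integration.integral_minus[symmetric], intro Bochner_Integration.integral_cong)
       (auto simp: std_normal_density_def hard_thr_def indicator_def)
  finally show ?thesis using eq by simp
qed

text \<open>
  On \<open>\<bar>x\<bar> > t\<close> one of \<open>exp (\<plusminus>t x - t\<^sup>2)\<close> is at least \<open>1\<close>; the exponential factors turn into shifts
  by \<open>\<plusminus>t\<close>.
\<close>

lemma nn_integral_std_normal_hard_thr_square_le:
  assumes "t \<ge> 0"
  shows "(\<integral>\<^sup>+x. ennreal ((hard_thr t x)\<^sup>2) \<partial>std_normal) \<le> ennreal (2 * exp (- (t\<^sup>2) / 2) * (1 + t\<^sup>2))"
proof -
  have pt: "(hard_thr t x)\<^sup>2 \<le> exp (- (t\<^sup>2) / 2) * (x\<^sup>2 * tilt t x + x\<^sup>2 * tilt (- t) x)" for x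
  proof (cases "\<bar>x\<bar> > t")
    case True
    have "1 \<le> exp (- (t\<^sup>2) / 2) * (tilt t x + tilt (- t) x)"
    proof (cases "x \<ge> 0")
      case True
      then have "t * t \<le> t * x" using \<open>\<bar>x\<bar> > t\<close> assms by (intro mult_left_mono) auto
      then have "1 \<le> exp (- (t\<^sup>2) / 2) * tilt t x"
        by (simp add: tilt_def power2_eq_square flip: exp_add)
      then show ?thesis using tilt_pos[of "-t" x] by (simp add: distrib_left add_increasing2)
    next
      case False
      then have "t * t \<le> t * (-x)" using \<open>\<bar>x\<bar> > t\<close> assms by (intro mult_left_mono) auto
      then have "1 \<le> exp (- (t\<^sup>2) / 2) * tilt (-t) x"
        by (simp add: tilt_def power2_eq_square flip: exp_add)
      then show ?thesis using tilt_pos[of "t" x] by (simp add: distrib_left add_increasing)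
    qed
    from mult_left_mono[OF this, of "x\<^sup>2"] True show ?thesis
      by (simp add: hard_thr_def algebra_simps)
  next
    case False
    then show ?thesis
      using tilt_pos[of t x] tilt_pos[of "-t" x] by (auto simp: hard_thr_def intro!: add_nonneg_nonneg)
  qed
  have "(\<integral>\<^sup>+x. ennreal ((hard_thr t x)\<^sup>2) \<partial>std_normal)
      \<le> (\<integral>\<^sup>+x. ennreal (exp (- (t\<^sup>2) / 2)) *
          (ennreal (x\<^sup>2) * ennreal (tilt t x) + ennreal (x\<^sup>2) * ennreal (tilt (- t) x)) \<partial>std_normal)"
    using pt tilt_pos
    by (intro nn_integral_mono) (simp add: less_imp_le flip: ennreal_mult' ennreal_plus)
  also have "\<dots> = ennreal (exp (- (t\<^sup>2) / 2)) *
      ((\<integral>\<^sup>+x. ennreal (x\<^sup>2) * ennreal (tilt t x) \<partial>std_normal) +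
       (\<integral>\<^sup>+x. ennreal (x\<^sup>2) * ennreal (tilt (- t) x) \<partial>std_normal))"
    by (subst nn_integral_cmult, measurable, subst nn_integral_add) auto
  also have "\<dots> = ennreal (exp (- (t\<^sup>2) / 2)) *
      ((\<integral>\<^sup>+x. ennreal ((t + x)\<^sup>2) \<partial>std_normal) + (\<integral>\<^sup>+x. ennreal ((- t + x)\<^sup>2) \<partial>std_normal))"
    by (subst (1 2) nn_integral_std_normal_shift[of "\<lambda>x. ennreal (x\<^sup>2)", symmetric]) auto
  \<comment> \<open>The cross terms of the two shifted squares cancel.\<close>
  also have "(\<integral>\<^sup>+x. ennreal ((t + x)\<^sup>2) \<partial>std_normal) + (\<integral>\<^sup>+x. ennreal ((- t + x)\<^sup>2) \<partial>std_normal)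
      = (\<integral>\<^sup>+x. ennreal (2 * t\<^sup>2) + 2 * ennreal (x\<^sup>2) \<partial>std_normal)"
  proof (subst nn_integral_add[symmetric], measurable, intro nn_integral_cong)
    fix x
    have "ennreal ((t + x)\<^sup>2) + ennreal ((- t + x)\<^sup>2) = ennreal ((t + x)\<^sup>2 + (- t + x)\<^sup>2)"
      by simp
    also have "(t + x)\<^sup>2 + (- t + x)\<^sup>2 = 2 * t\<^sup>2 + 2 * x\<^sup>2"
      by (simp add: power2_eq_square algebra_simps)
    also have "ennreal (2 * t\<^sup>2 + 2 * x\<^sup>2) = ennreal (2 * t\<^sup>2) + 2 * ennreal (x\<^sup>2)"
      by (simp add: ennreal_mult')
    finally show "ennreal ((t + x)\<^sup>2) + ennreal ((- t + x)\<^sup>2) = ennreal (2 * t\<^sup>2) + 2 * ennreal (x\<^sup>2)" .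
  qed
  also have "\<dots> = ennreal (2 * t\<^sup>2) + 2"
    using std_normal.emeasure_space_1
    by (subst nn_integral_add)
       (auto simp: nn_integral_cmult nn_integral_std_normal_square)
  also have "ennreal (exp (- (t\<^sup>2) / 2)) * (ennreal (2 * t\<^sup>2) + 2)
      = ennreal (2 * exp (- (t\<^sup>2) / 2) * (1 + t\<^sup>2))"
    by (simp add: algebra_simps flip: ennreal_plus ennreal_mult' ennreal_numeral)
  finally show ?thesis .
qed

section \<open>Vectors of independent standard normal variables\<close>

lemma std_normals_component_measurable:
  "i \<in> I \<Longrightarrow> (\<lambda>x. x i) \<in> borel_measurable (PiM I (\<lambda>_. std_normal))"
  using measurable_component_singleton[of i I "\<lambda>_. std_normal"] by simp

lemma nn_integral_std_normals_component:
  assumes "i \<in> I" and "f \<in> borel_measurable borel"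
  shows "(\<integral>\<^sup>+x. f (x i) \<partial>PiM I (\<lambda>_. std_normal)) = (\<integral>\<^sup>+x. f x \<partial>std_normal)"
proof -
  have "(\<integral>\<^sup>+x. f x \<partial>std_normal) = (\<integral>\<^sup>+x. f x \<partial>distr (PiM I (\<lambda>_. std_normal)) std_normal (\<lambda>x. x i))"
    by (simp only: distr_PiM_component[OF std_normal.prob_space_axioms assms(1)])
  also have "\<dots> = (\<integral>\<^sup>+x. f (x i) \<partial>PiM I (\<lambda>_. std_normal))"
    by (intro nn_integral_distr measurable_component_singleton assms(1)) (use assms in simp)
  finally show ?thesis by simp
qed

text \<open>Independence: the integrand is a product over all coordinates, with factor 1 away from
  \<open>i\<close> and \<open>j\<close>, so its integral is the product of one-dimensional
  integrals. For distinct \<open>i\<close> and \<open>j\<close> a centred factor annihilates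
  it.\<close>

lemma has_bochner_integral_std_normals_hard_thr_mult:
  assumes "finite I" "i \<in> I" "j \<in> I"
  shows "has_bochner_integral (PiM I (\<lambda>_. std_normal)) (\<lambda>x. hard_thr t (x i) * hard_thr t (x j))
    (if i = j then \<integral>x. (hard_thr t x)\<^sup>2 \<partial>std_normal else 0)"
proof -
  define f where "f k x = (if k = i then hard_thr t x else 1) * (if k = j then hard_thr t x else 1)"
    for k x
  have prod: "(\<Prod>k\<in>I. f k (x k)) = hard_thr t (x i) * hard_thr t (x j)" for x
    using assms by (simp add: f_def prod.distrib prod.delta)
  have int: "integrable std_normal (f k)" for k
    using integrable_std_normal_hard_thr_square[of t] integrable_std_normal_hard_thr[of t]
    unfolding f_def[abs_def] by (cases "k = i"; cases "k = j") (auto simp: power2_eq_square)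
  have "(\<Prod>k\<in>I. \<integral>x. f k x \<partial>std_normal) = (if i = j then \<integral>x. (hard_thr t x)\<^sup>2 \<partial>std_normal else 0)"
  proof (cases "i = j")
    case True
    have "(\<integral>x. f k x \<partial>std_normal) = (if k = i then \<integral>x. (hard_thr t x)\<^sup>2 \<partial>std_normal else 1)" for k
      using True std_normal.prob_space by (simp add: f_def power2_eq_square)
    then show ?thesis using True assms by (simp add: prod.delta)
  next
    case False
    then have "(\<integral>x. f i x \<partial>std_normal) = 0"
      by (simp add: f_def integral_std_normal_hard_thr)
    then show ?thesis using False assms by (auto intro!: prod_zero)
  qed
  moreover have "(\<integral>x. (\<Prod>k\<in>I. f k (x k)) \<partial>PiM I (\<lambda>_. std_normal)) = (\<Prod>k\<in>I. \<integral>x. f k x \<partial>std_normal)"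
    by (rule std_normals.product_integral_prod) (use assms int in auto)
  moreover have "integrable (PiM I (\<lambda>_. std_normal)) (\<lambda>x. \<Prod>k\<in>I. f k (x k))"
    by (rule std_normals.product_integrable_prod) (use assms int in auto)
  ultimately show ?thesis
    by (simp add: prod has_bochner_integral_iff)
qed

text \<open>In the expanded square only the diagonal terms survive, so the variance grows like
  \<open>card J\<close> and not like its square.\<close>

lemma nn_integral_std_normals_sum_hard_thr_square:
  assumes "finite I" "J \<subseteq> I"
  shows "(\<integral>\<^sup>+x. ennreal ((\<Sum>j\<in>J. hard_thr t (x j))\<^sup>2) \<partial>PiM I (\<lambda>_. std_normal))
    = of_nat (card J) * (\<integral>\<^sup>+x. ennreal ((hard_thr t x)\<^sup>2) \<partial>std_normal)"
proof -
  let ?v = "\<integral>x. (hard_thr t x)\<^sup>2 \<partial>std_normal"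
  have fin: "finite J" using assms finite_subset by blast
  have "has_bochner_integral (PiM I (\<lambda>_. std_normal))
      (\<lambda>x. \<Sum>i\<in>J. \<Sum>j\<in>J. hard_thr t (x i) * hard_thr t (x j)) (\<Sum>i\<in>J. \<Sum>j\<in>J. if i = j then ?v else 0)"
    using assms by (intro has_bochner_integral_sum has_bochner_integral_std_normals_hard_thr_mult) auto
  then have "has_bochner_integral (PiM I (\<lambda>_. std_normal))
      (\<lambda>x. (\<Sum>j\<in>J. hard_thr t (x j))\<^sup>2) (card J * ?v)"
    using fin by (simp add: power2_eq_square sum_product sum.delta)
  then have "(\<integral>\<^sup>+x. ennreal ((\<Sum>j\<in>J. hard_thr t (x j))\<^sup>2) \<partial>PiM I (\<lambda>_. std_normal)) = ennreal (card J * ?v)"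
    by (subst nn_integral_eq_integral) (auto simp: has_bochner_integral_iff)
  also have "\<dots> = of_nat (card J) * ennreal ?v"
    by (simp add: ennreal_mult' ennreal_of_nat_eq_real_of_nat)
  also have "ennreal ?v = (\<integral>\<^sup>+x. ennreal ((hard_thr t x)\<^sup>2) \<partial>std_normal)"
    by (intro nn_integral_eq_integral[symmetric] integrable_std_normal_hard_thr_square) auto
  finally show ?thesis .
qed

lemma mse_conv_std_normals:
  assumes "T \<in> estimators d"
  shows "mse \<sigma> d T \<theta> = (\<integral>\<^sup>+x. ennreal ((T (\<lambda>j\<in>{1..d}. \<theta> j + \<sigma> * x j) - lin d \<theta>)\<^sup>2)
    \<partial>PiM {1..d} (\<lambda>_. std_normal))"
proof -
  have [measurable]: "T \<in> borel_measurable (Rd d)"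
    using assms by (simp add: estimators_def)
  show ?thesis
    unfolding mse_def obs_law_def by (subst nn_integral_distr[OF obs_map_measurable]) simp_all
qed

section \<open>Upper bound\<close>

text \<open>Without thresholding the error is the total noise, of variance
  \<open>\<sigma>\<^sup>2 * d\<close>. Here \<open>d / s\<^sup>2\<close> is at most 1, where
  \<open>ln (1 + x)\<close> is comparable to \<open>x\<close>.\<close>

lemma mse_L_hat_dense_le:
  assumes "\<sigma> > 0" "sqrt (real d) \<le> real s" "1 \<le> s"
  shows "mse \<sigma> d (L_hat \<sigma> d s) \<theta> \<le> ennreal (32 * \<sigma>\<^sup>2 * (real s)\<^sup>2 * ln (1 + real d / (real s)\<^sup>2))"
proof -
  \<comment> \<open>\<open>hard_thr (-1)\<close> is the identity, which makes the variance formula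
    for thresholded sums applicable to the plain sum.\<close>
  have err: "(L_hat \<sigma> d s (\<lambda>j\<in>{1..d}. \<theta> j + \<sigma> * x j) - lin d \<theta>)\<^sup>2 = \<sigma>\<^sup>2 * (\<Sum>j=1..d. hard_thr (-1) (x j))\<^sup>2"
    for x
    using assms
    by (simp add: L_hat_def lin_def hard_thr_neg_level sum.distrib power_mult_distrib flip: sum_distrib_left)
  have "mse \<sigma> d (L_hat \<sigma> d s) \<theta> = ennreal (\<sigma>\<^sup>2 * real d)"
    using nn_integral_std_normals_sum_hard_thr_square[of "{1..d}" "{1..d}" "-1"]
    unfolding mse_conv_std_normals[OF L_hat_in_estimators] err
    by (simp add: ennreal_mult' nn_integral_cmult hard_thr_neg_level nn_integral_std_normal_square
        ennreal_of_nat_eq_real_of_nat)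
  also have "\<sigma>\<^sup>2 * real d \<le> \<sigma>\<^sup>2 * (32 * (real s)\<^sup>2 * ln (1 + real d / (real s)\<^sup>2))"
  proof (rule mult_left_mono)
    \<comment> \<open>The chain is \<open>x / 2 \<le> x / (1 + x) \<le> ln (1 + x)\<close> on the
      unit interval, whose second inequality is \<open>ln (1 - u) \<le> - u\<close> at
      \<open>u = x / (1 + x)\<close>. It gives the factor 2; the larger 32 is the constant of the
      sparse regime.\<close>
    define x where "x = real d / (real s)\<^sup>2"
    have "real d \<le> (real s)\<^sup>2"
      using assms(2) by (metis of_nat_0_le_iff real_sqrt_le_iff real_sqrt_unique)
    then have x: "0 \<le> x" "x \<le> 1" using assms by (auto simp: x_def)
    then have "x * 1 \<le> x * (2 / (1 + x))" by (intro mult_left_mono) (auto simp: field_simps)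
    then have "x \<le> 2 * (x / (1 + x))" by (simp add: mult_ac)
    moreover have "x / (1 + x) \<le> ln (1 + x)"
      using ln_add_one_self_le_self2[of "- x / (1 + x)"] x ln_one_minus_pos_upper_bound[of "x / (1 + x)"]
      by (simp add: field_simps ln_div)
    moreover have "0 \<le> ln (1 + x)" using x by simp
    ultimately have "x \<le> 32 * ln (1 + x)" by linarith
    then show "real d \<le> 32 * (real s)\<^sup>2 * ln (1 + real d / (real s)\<^sup>2)"
      using assms by (simp add: x_def field_simps)
  qed simp
  finally show ?thesis by (simp add: mult_ac ennreal_leI)
qed

section \<open>Risk of the thresholded sum in the sparse regime\<close>

text \<open>Cauchy-Schwarz against the constant 1 costs a factor \<open>card S\<close>. This is
  affordable on the support, since the target rate is itself quadratic in the sparsity.\<close>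

lemma nn_integral_std_normals_sum_abs_square_le:
  assumes "S \<subseteq> I" "finite I"
  shows "(\<integral>\<^sup>+x. ennreal ((\<Sum>j\<in>S. \<bar>x j\<bar> + \<tau>)\<^sup>2) \<partial>PiM I (\<lambda>_. std_normal))
    \<le> ennreal (2 * (real (card S))\<^sup>2 * (1 + \<tau>\<^sup>2))"
proof -
  have fin: "finite S" using assms finite_subset by blast
  have pt: "(\<Sum>j\<in>S. \<bar>x j\<bar> + \<tau>)\<^sup>2 \<le> 2 * real (card S) * (\<Sum>j\<in>S. (x j)\<^sup>2 + \<tau>\<^sup>2)" for x :: "'a \<Rightarrow> real"
  proof -
    have "(\<Sum>j\<in>S. \<bar>x j\<bar> + \<tau>)\<^sup>2 \<le> (\<Sum>j\<in>S. (\<bar>x j\<bar> + \<tau>)\<^sup>2) * (\<Sum>j\<in>S. 1\<^sup>2)"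
      using Cauchy_Schwarz_ineq_sum[of "\<lambda>j. \<bar>x j\<bar> + \<tau>" "\<lambda>_. 1" S] by simp
    also have "\<dots> \<le> (\<Sum>j\<in>S. 2 * ((x j)\<^sup>2 + \<tau>\<^sup>2)) * (\<Sum>j\<in>S. 1\<^sup>2)"
    proof (intro mult_right_mono sum_mono)
      fix j
      show "(\<bar>x j\<bar> + \<tau>)\<^sup>2 \<le> 2 * ((x j)\<^sup>2 + \<tau>\<^sup>2)"
        using sum_squares_bound[of "\<bar>x j\<bar>" \<tau>] by (simp add: power2_sum)
    qed simp
    also have "\<dots> = 2 * real (card S) * (\<Sum>j\<in>S. (x j)\<^sup>2 + \<tau>\<^sup>2)"
      unfolding sum_distrib_left[symmetric] by simp
    finally show ?thesis .
  qed
  have "(\<integral>\<^sup>+x. ennreal ((\<Sum>j\<in>S. \<bar>x j\<bar> + \<tau>)\<^sup>2) \<partial>PiM I (\<lambda>_. std_normal))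
    \<le> (\<integral>\<^sup>+x. ennreal (2 * real (card S)) * (\<Sum>j\<in>S. ennreal ((x j)\<^sup>2) + ennreal (\<tau>\<^sup>2))
        \<partial>PiM I (\<lambda>_. std_normal))"
    using pt by (intro nn_integral_mono) (simp add: ennreal_leI flip: ennreal_mult' ennreal_plus)
  also have "\<dots> = ennreal (2 * real (card S)) *
      (\<Sum>j\<in>S. (\<integral>\<^sup>+x. ennreal ((x j)\<^sup>2) + ennreal (\<tau>\<^sup>2) \<partial>PiM I (\<lambda>_. std_normal)))"
  proof -
    have [measurable]: "(\<lambda>x. x j) \<in> borel_measurable (PiM I (\<lambda>_. std_normal))" if "j \<in> S" for j
      using assms that by (intro std_normals_component_measurable) auto
    show ?thesis
      by (subst nn_integral_cmult, measurable, subst nn_integral_sum) auto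
  qed
  also have "(\<Sum>j\<in>S. (\<integral>\<^sup>+x. ennreal ((x j)\<^sup>2) + ennreal (\<tau>\<^sup>2) \<partial>PiM I (\<lambda>_. std_normal)))
      = (\<Sum>j\<in>S. ennreal (1 + \<tau>\<^sup>2))"
  proof (rule sum.cong)
    fix j assume "j \<in> S"
    then have j: "j \<in> I" using assms by auto
    have "(\<integral>\<^sup>+x. ennreal ((x j)\<^sup>2) + ennreal (\<tau>\<^sup>2) \<partial>PiM I (\<lambda>_. std_normal))
      = (\<integral>\<^sup>+x. ennreal (x\<^sup>2) + ennreal (\<tau>\<^sup>2) \<partial>std_normal)"
      by (rule nn_integral_std_normals_component) (use assms j in auto)
    also have "\<dots> = ennreal (1 + \<tau>\<^sup>2)"
      using std_normal.emeasure_space_1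
      by (subst nn_integral_add) (auto simp: nn_integral_std_normal_square)
    finally show "(\<integral>\<^sup>+x. ennreal ((x j)\<^sup>2) + ennreal (\<tau>\<^sup>2) \<partial>PiM I (\<lambda>_. std_normal)) = ennreal (1 + \<tau>\<^sup>2)" .
  qed simp
  also have "ennreal (2 * real (card S)) * (\<Sum>j\<in>S. ennreal (1 + \<tau>\<^sup>2))
      = ennreal (2 * (real (card S))\<^sup>2 * (1 + \<tau>\<^sup>2))"
    by (simp add: power2_eq_square mult_ac ennreal_of_nat_eq_real_of_nat flip: ennreal_mult' del: ennreal_plus)
  finally show ?thesis .
qed

lemma L_hat_sparse_error_le:
  fixes \<theta> x :: "nat \<Rightarrow> real"
  assumes "\<sigma> > 0" "real s < sqrt (real d)"
  defines "\<tau> \<equiv> sqrt (2 * ln (1 + real d / (real s)\<^sup>2))"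
  defines "S \<equiv> {j \<in> {1..d}. \<theta> j \<noteq> 0}"
  shows "(L_hat \<sigma> d s (\<lambda>j\<in>{1..d}. \<theta> j + \<sigma> * x j) - lin d \<theta>)\<^sup>2
    \<le> 2 * \<sigma>\<^sup>2 * ((\<Sum>j\<in>S. \<bar>x j\<bar> + \<tau>)\<^sup>2 + (\<Sum>j\<in>{1..d}-S. hard_thr \<tau> (x j))\<^sup>2)"
proof -
  let ?T = "\<lambda>y. y * indicat_real {x. \<bar>x\<bar> > \<sigma> * \<tau>} y"
  have "L_hat \<sigma> d s (\<lambda>j\<in>{1..d}. \<theta> j + \<sigma> * x j) - lin d \<theta> = (\<Sum>j=1..d. ?T (\<theta> j + \<sigma> * x j) - \<theta> j)"
    using assms by (simp add: L_hat_def lin_def sum_subtractf)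
  also have "\<dots> = (\<Sum>j\<in>{1..d}-S. ?T (\<theta> j + \<sigma> * x j) - \<theta> j) + (\<Sum>j\<in>S. ?T (\<theta> j + \<sigma> * x j) - \<theta> j)"
    by (rule sum.subset_diff) (auto simp: S_def)
  \<comment> \<open>Off the support the observation is pure noise, and \<open>\<sigma> > 0\<close>
    cancels from the comparison of \<open>\<bar>\<sigma> * x j\<bar>\<close> with
    \<open>\<sigma> * \<tau>\<close>.\<close>
  also have "(\<Sum>j\<in>{1..d}-S. ?T (\<theta> j + \<sigma> * x j) - \<theta> j) = \<sigma> * (\<Sum>j\<in>{1..d}-S. hard_thr \<tau> (x j))"
    unfolding sum_distrib_left using \<open>\<sigma> > 0\<close>
    by (intro sum.cong) (auto simp: S_def hard_thr_def indicator_def abs_mult)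
  finally have eq: "L_hat \<sigma> d s (\<lambda>j\<in>{1..d}. \<theta> j + \<sigma> * x j) - lin d \<theta>
      = \<sigma> * (\<Sum>j\<in>{1..d}-S. hard_thr \<tau> (x j)) + (\<Sum>j\<in>S. ?T (\<theta> j + \<sigma> * x j) - \<theta> j)" (is "_ = \<sigma> * ?B + ?A") .
  have "\<bar>?A\<bar> \<le> (\<Sum>j\<in>S. \<bar>?T (\<theta> j + \<sigma> * x j) - \<theta> j\<bar>)"
    by (rule sum_abs)
  also have "\<dots> \<le> (\<Sum>j\<in>S. \<sigma> * (\<bar>x j\<bar> + \<tau>))"
  proof (rule sum_mono)
    \<comment> \<open>A kept observation errs by its noise alone. A discarded one is at most
      \<open>\<sigma> * \<tau>\<close> in absolute value, so the lost \<open>\<theta> j\<close> is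
      at most \<open>\<sigma> * \<tau>\<close> plus the noise.\<close>
    fix j
    have "\<bar>\<sigma> * x j\<bar> = \<sigma> * \<bar>x j\<bar>" "0 \<le> \<sigma> * \<tau>"
      using \<open>\<sigma> > 0\<close> by (auto simp: abs_mult \<tau>_def)
    then show "\<bar>?T (\<theta> j + \<sigma> * x j) - \<theta> j\<bar> \<le> \<sigma> * (\<bar>x j\<bar> + \<tau>)"
      unfolding distrib_left indicator_def by auto
  qed
  finally have "\<bar>?A\<bar> \<le> \<sigma> * (\<Sum>j\<in>S. \<bar>x j\<bar> + \<tau>)" by (simp add: sum_distrib_left)
  then have "?A\<^sup>2 \<le> (\<sigma> * (\<Sum>j\<in>S. \<bar>x j\<bar> + \<tau>))\<^sup>2"
    by (rule abs_le_square_iff[THEN iffD1, OF order_trans]) simp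
  moreover have "(\<sigma> * ?B + ?A)\<^sup>2 \<le> 2 * ((\<sigma> * ?B)\<^sup>2 + ?A\<^sup>2)"
    using sum_squares_bound[of "\<sigma> * ?B" ?A] by (simp add: power2_sum)
  ultimately show ?thesis
    unfolding eq by (simp add: power_mult_distrib algebra_simps)
qed

text \<open>The level balances the two sources of error: support and complement are each bounded by
  \<open>2 * s\<^sup>2 * (1 + \<tau>\<^sup>2)\<close> in noise units.\<close>

lemma mse_L_hat_sparse_le:
  assumes "\<sigma> > 0" "real s < sqrt (real d)" "1 \<le> s" "l0_norm d \<theta> \<le> s"
  shows "mse \<sigma> d (L_hat \<sigma> d s) \<theta> \<le> ennreal (32 * \<sigma>\<^sup>2 * (real s)\<^sup>2 * ln (1 + real d / (real s)\<^sup>2))"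
proof -
  define \<tau> where "\<tau> = sqrt (2 * ln (1 + real d / (real s)\<^sup>2))"
  define S where "S = {j \<in> {1..d}. \<theta> j \<noteq> 0}"
  let ?P = "PiM {1..d} (\<lambda>_. std_normal)"
  have S: "S \<subseteq> {1..d}" "card S \<le> s"
    using assms by (auto simp: S_def l0_norm_def)
  have "(real s)\<^sup>2 < real d"
    using assms(2) by (metis of_nat_0_le_iff real_sqrt_less_iff real_sqrt_unique)
  then have x1: "1 < real d / (real s)\<^sup>2" using assms by simp
  have \<tau>2: "\<tau>\<^sup>2 = 2 * ln (1 + real d / (real s)\<^sup>2)"
    unfolding \<tau>_def using x1 by (intro real_sqrt_pow2) simp
  have \<tau>0: "\<tau> \<ge> 0" using x1 by (simp add: \<tau>_def)
  \<comment> \<open>The regime \<open>s\<^sup>2 < d\<close> keeps \<open>\<tau>\<^sup>2\<close>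
    above \<open>2 * ln 2\<close>, hence above 1; this later allows
    \<open>1 + \<tau>\<^sup>2 \<le> 2 * \<tau>\<^sup>2\<close>.\<close>
  have "ln 2 \<le> ln (1 + real d / (real s)\<^sup>2)" using x1 by simp
  then have \<tau>1: "1 \<le> \<tau>\<^sup>2" unfolding \<tau>2 using ln2_ge_two_thirds by simp
  \<comment> \<open>The level is chosen for this: \<open>exp (- \<tau>\<^sup>2 / 2)\<close> equals
    \<open>1 / (1 + d / s\<^sup>2)\<close>, so the total of up to \<open>d\<close> small variances
    is of order \<open>s\<^sup>2 * (1 + \<tau>\<^sup>2)\<close>.\<close>
  have exp_\<tau>: "exp (- (\<tau>\<^sup>2) / 2) * real d \<le> (real s)\<^sup>2"
  proof -
    have "exp (- (\<tau>\<^sup>2) / 2) = inverse (1 + real d / (real s)\<^sup>2)"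
      unfolding \<tau>2 using x1 by (simp add: exp_minus)
    also have "\<dots> \<le> inverse (real d / (real s)\<^sup>2)"
      using x1 by (intro le_imp_inverse_le) auto
    finally have "exp (- (\<tau>\<^sup>2) / 2) * real d \<le> inverse (real d / (real s)\<^sup>2) * real d"
      by (intro mult_right_mono) auto
    then show ?thesis using x1 by (auto split: if_splits)
  qed
  have "mse \<sigma> d (L_hat \<sigma> d s) \<theta>
     \<le> (\<integral>\<^sup>+x. ennreal (2 * \<sigma>\<^sup>2) * (ennreal ((\<Sum>j\<in>S. \<bar>x j\<bar> + \<tau>)\<^sup>2)
          + ennreal ((\<Sum>j\<in>{1..d}-S. hard_thr \<tau> (x j))\<^sup>2)) \<partial>?P)"
    unfolding mse_conv_std_normals[OF L_hat_in_estimators]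
    using L_hat_sparse_error_le[OF assms(1,2)]
    by (intro nn_integral_mono) (simp add: ennreal_leI \<tau>_def S_def flip: ennreal_mult' ennreal_plus)
  also have "\<dots> = ennreal (2 * \<sigma>\<^sup>2) * ((\<integral>\<^sup>+x. ennreal ((\<Sum>j\<in>S. \<bar>x j\<bar> + \<tau>)\<^sup>2) \<partial>?P)
      + (\<integral>\<^sup>+x. ennreal ((\<Sum>j\<in>{1..d}-S. hard_thr \<tau> (x j))\<^sup>2) \<partial>?P))"
  proof -
    have [measurable]: "(\<lambda>x. \<Sum>j\<in>S. \<bar>x j\<bar> + \<tau>) \<in> borel_measurable ?P"
      by (intro borel_measurable_sum borel_measurable_add borel_measurable_abs
          std_normals_component_measurable borel_measurable_const) (use S in blast)
    have [measurable]: "(\<lambda>x. \<Sum>j\<in>{1..d}-S. hard_thr \<tau> (x j)) \<in> borel_measurable ?P"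
      by (intro borel_measurable_sum measurable_compose[OF _ hard_thr_measurable]
          std_normals_component_measurable) blast
    show ?thesis
      by (subst nn_integral_cmult, measurable, rule arg_cong[where f = "(*) _"], rule nn_integral_add) measurable
  qed
  also have "\<dots> \<le> ennreal (2 * \<sigma>\<^sup>2) * (ennreal (2 * (real s)\<^sup>2 * (1 + \<tau>\<^sup>2)) +
      ennreal (2 * (real s)\<^sup>2 * (1 + \<tau>\<^sup>2)))"
  proof (intro mult_left_mono add_mono)
    have "(\<integral>\<^sup>+x. ennreal ((\<Sum>j\<in>S. \<bar>x j\<bar> + \<tau>)\<^sup>2) \<partial>?P) \<le> ennreal (2 * (real (card S))\<^sup>2 * (1 + \<tau>\<^sup>2))"
      by (rule nn_integral_std_normals_sum_abs_square_le) (use S in auto)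
    also have "\<dots> \<le> ennreal (2 * (real s)\<^sup>2 * (1 + \<tau>\<^sup>2))"
      using S by (intro ennreal_leI mult_right_mono mult_left_mono power_mono) auto
    finally show "(\<integral>\<^sup>+x. ennreal ((\<Sum>j\<in>S. \<bar>x j\<bar> + \<tau>)\<^sup>2) \<partial>?P) \<le> ennreal (2 * (real s)\<^sup>2 * (1 + \<tau>\<^sup>2))" .
    have "(\<integral>\<^sup>+x. ennreal ((\<Sum>j\<in>{1..d}-S. hard_thr \<tau> (x j))\<^sup>2) \<partial>?P)
      = of_nat (card ({1..d}-S)) * (\<integral>\<^sup>+x. ennreal ((hard_thr \<tau> x)\<^sup>2) \<partial>std_normal)"
      by (rule nn_integral_std_normals_sum_hard_thr_square) auto
    also have "\<dots> \<le> of_nat d * ennreal (2 * exp (- (\<tau>\<^sup>2) / 2) * (1 + \<tau>\<^sup>2))"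
      using card_mono[of "{1..d}" "{1..d}-S"] \<tau>0
      by (intro mult_mono nn_integral_std_normal_hard_thr_square_le) auto
    also have "\<dots> = ennreal (2 * (exp (- (\<tau>\<^sup>2) / 2) * real d) * (1 + \<tau>\<^sup>2))"
      by (simp add: ennreal_of_nat_eq_real_of_nat mult_ac flip: ennreal_mult' del: ennreal_plus)
    also have "\<dots> \<le> ennreal (2 * (real s)\<^sup>2 * (1 + \<tau>\<^sup>2))"
      using exp_\<tau> by (intro ennreal_leI mult_right_mono mult_left_mono) auto
    finally show "(\<integral>\<^sup>+x. ennreal ((\<Sum>j\<in>{1..d}-S. hard_thr \<tau> (x j))\<^sup>2) \<partial>?P)
      \<le> ennreal (2 * (real s)\<^sup>2 * (1 + \<tau>\<^sup>2))" .
  qed auto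
  also have "\<dots> = ennreal (8 * \<sigma>\<^sup>2 * (real s)\<^sup>2 * (1 + \<tau>\<^sup>2))"
    by (subst ennreal_plus[symmetric], simp, simp, subst ennreal_mult'[symmetric], simp)
       (simp add: algebra_simps)
  \<comment> \<open>The constant 32 arises here as 8 * 2 * 2, the last factor coming from
    \<open>\<tau>\<^sup>2 = 2 * ln (1 + d / s\<^sup>2)\<close>.\<close>
  also have "\<dots> \<le> ennreal (8 * \<sigma>\<^sup>2 * (real s)\<^sup>2 * (2 * \<tau>\<^sup>2))"
    using \<tau>1 by (intro ennreal_leI mult_left_mono) auto
  finally show ?thesis by (simp add: \<tau>2 mult_ac)
qed

section \<open>Lower bound\<close>

text \<open>Both measures are identified with the product \<open>PiM I M'\<close> of the shifted
  coordinate laws. A finite product measure is determined by its values on boxes, where the left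
  side factors through preimages and the right side through its integrand.\<close>

lemma distr_std_normals_shift:
  assumes "finite I"
  shows "distr (PiM I (\<lambda>_. std_normal)) (PiM I (\<lambda>_. std_normal)) (\<lambda>x. \<lambda>j\<in>I. \<mu> j + x j)
    = density (PiM I (\<lambda>_. std_normal)) (\<lambda>x. \<Prod>j\<in>I. ennreal (tilt (\<mu> j) (x j)))" (is "?L = ?R")
proof -
  define M' where "M' j = distr std_normal std_normal (\<lambda>x. \<mu> j + x)" for j
  interpret M': product_prob_space M'
    unfolding M'_def by (intro product_prob_spaceI std_normal.prob_space_distr) simp
  have sets: "sets (PiM I (\<lambda>_. std_normal)) = sets (PiM I M')"
    by (intro sets_PiM_cong) (auto simp: M'_def)
  \<comment> \<open>The one-dimensional case of the claim.\<close>
  have em: "emeasure (M' j) A = (\<integral>\<^sup>+x. ennreal (tilt (\<mu> j) x) * indicator A x \<partial>std_normal)"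
    if [measurable]: "A \<in> sets borel" for j A
  proof -
    have "emeasure (M' j) A = (\<integral>\<^sup>+x. indicator A x \<partial>M' j)"
      using that by (simp add: M'_def)
    also have "\<dots> = (\<integral>\<^sup>+x. indicator A (\<mu> j + x) \<partial>std_normal)"
      unfolding M'_def by (subst nn_integral_distr) auto
    also have "\<dots> = (\<integral>\<^sup>+x. indicator A x * ennreal (tilt (\<mu> j) x) \<partial>std_normal)"
      by (rule nn_integral_std_normal_shift) simp
    finally show ?thesis by (simp add: mult.commute)
  qed
  have PiE: "Pi\<^sub>E I A \<in> sets (PiM I (\<lambda>_. std_normal))"
    if "\<And>i. i \<in> I \<Longrightarrow> A i \<in> sets borel" for A
    by (intro sets_PiM_I_finite assms) (use that in simp)
  have shift: "(\<lambda>x. \<lambda>j\<in>I. \<mu> j + x j) \<in> PiM I (\<lambda>_. std_normal) \<rightarrow>\<^sub>M PiM I (\<lambda>_. std_normal)"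
    by measurable
  have "?L = PiM I M'"
  proof (rule M'.PiM_eqI)
    fix A assume "\<And>i. i \<in> I \<Longrightarrow> A i \<in> sets (M' i)"
    then have A: "\<And>i. i \<in> I \<Longrightarrow> A i \<in> sets borel" by (simp add: M'_def)
    have vimage: "(\<lambda>x. \<mu> j + x) -` A j \<in> sets borel" if "j \<in> I" for j
      using measurable_sets[of "\<lambda>x. \<mu> j + x" borel borel "A j"] A[OF that] by simp
    have "(\<lambda>x. \<lambda>j\<in>I. \<mu> j + x j) -` Pi\<^sub>E I A \<inter> space (PiM I (\<lambda>_. std_normal))
      = (\<Pi>\<^sub>E j\<in>I. (\<lambda>x. \<mu> j + x) -` A j)"
      by (auto simp: space_PiM PiE_iff)
    then have "emeasure ?L (Pi\<^sub>E I A) = emeasure (PiM I (\<lambda>_. std_normal)) (\<Pi>\<^sub>E j\<in>I. (\<lambda>x. \<mu> j + x) -` A j)"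
      using A by (simp add: emeasure_distr[OF shift PiE])
    also have "\<dots> = (\<Prod>j\<in>I. emeasure std_normal ((\<lambda>x. \<mu> j + x) -` A j))"
      by (intro std_normals.emeasure_PiM assms) (use vimage in simp)
    also have "\<dots> = (\<Prod>j\<in>I. emeasure (M' j) (A j))"
    proof (rule prod.cong)
      fix j assume "j \<in> I"
      then show "emeasure std_normal ((\<lambda>x. \<mu> j + x) -` A j) = emeasure (M' j) (A j)"
        unfolding M'_def using A by (subst emeasure_distr) simp_all
    qed simp
    finally show "emeasure ?L (Pi\<^sub>E I A) = (\<Prod>j\<in>I. emeasure (M' j) (A j))" .
  qed (simp_all add: assms sets)
  moreover have "?R = PiM I M'"
  proof (rule M'.PiM_eqI)
    fix A assume "\<And>i. i \<in> I \<Longrightarrow> A i \<in> sets (M' i)"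
    then have A: "\<And>i. i \<in> I \<Longrightarrow> A i \<in> sets borel" by (simp add: M'_def)
    have "(\<lambda>x. \<Prod>j\<in>I. ennreal (tilt (\<mu> j) (x j))) \<in> borel_measurable (PiM I (\<lambda>_. std_normal))"
      by (intro borel_measurable_prod_ennreal measurable_compose[OF _ measurable_ennreal]
          measurable_compose[OF _ tilt_measurable] std_normals_component_measurable)
    then have "emeasure ?R (Pi\<^sub>E I A)
      = (\<integral>\<^sup>+x. (\<Prod>j\<in>I. ennreal (tilt (\<mu> j) (x j))) * indicator (Pi\<^sub>E I A) x \<partial>PiM I (\<lambda>_. std_normal))"
      by (rule emeasure_density[OF _ PiE[OF A]])
    also have "\<dots> = (\<integral>\<^sup>+x. (\<Prod>j\<in>I. ennreal (tilt (\<mu> j) (x j)) * indicator (A j) (x j)) \<partial>PiM I (\<lambda>_. std_normal))"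
    proof (rule nn_integral_cong)
      fix x assume "x \<in> space (PiM I (\<lambda>_. std_normal))"
      then have x: "x \<in> Pi\<^sub>E I A \<longleftrightarrow> (\<forall>j\<in>I. x j \<in> A j)"
        by (simp add: space_PiM PiE_iff)
      have "indicator (Pi\<^sub>E I A) x = (\<Prod>j\<in>I. indicator (A j) (x j) :: ennreal)"
      proof (cases "\<forall>j\<in>I. x j \<in> A j")
        case True
        then show ?thesis using x by simp
      next
        case False
        then obtain j where "j \<in> I" "x j \<notin> A j" by blast
        then have "(\<Prod>j\<in>I. indicator (A j) (x j) :: ennreal) = 0"
          by (intro prod_zero assms bexI[of _ j]) simp_all
        moreover have "x \<notin> Pi\<^sub>E I A" using x False by blast
        ultimately show ?thesis by simp
      qed
      then show "(\<Prod>j\<in>I. ennreal (tilt (\<mu> j) (x j))) * indicator (Pi\<^sub>E I A) x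
          = (\<Prod>j\<in>I. ennreal (tilt (\<mu> j) (x j)) * indicator (A j) (x j))"
        by (simp only: prod.distrib)
    qed
    also have "\<dots> = (\<Prod>j\<in>I. \<integral>\<^sup>+x. ennreal (tilt (\<mu> j) x) * indicator (A j) x \<partial>std_normal)"
      by (rule std_normals.product_nn_integral_prod[OF assms]) (use A in simp)
    also have "\<dots> = (\<Prod>j\<in>I. emeasure (M' j) (A j))"
      by (intro prod.cong refl em[symmetric] A)
    finally show "emeasure ?R (Pi\<^sub>E I A) = (\<Prod>j\<in>I. emeasure (M' j) (A j))" .
  qed (simp_all add: assms sets)
  ultimately show ?thesis by simp
qed

text \<open>The likelihood ratio of the vector shifted by \<open>\<mu>\<close> against the unshifted
  one. It is real-valued, so that the pointwise inequality of the lower bound is plain real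
  algebra.\<close>

definition lr :: "'i set \<Rightarrow> ('i \<Rightarrow> real) \<Rightarrow> ('i \<Rightarrow> real) \<Rightarrow> real" where
  "lr I \<mu> x = (\<Prod>j\<in>I. tilt (\<mu> j) (x j))"

lemma lr_nonneg: "0 \<le> lr I \<mu> x"
  unfolding lr_def by (intro prod_nonneg less_imp_le tilt_pos)

lemma lr_measurable [measurable]: "lr I \<mu> \<in> borel_measurable (PiM I (\<lambda>_. std_normal))"
  unfolding lr_def[abs_def]
  by (intro borel_measurable_prod measurable_compose[OF _ tilt_measurable] std_normals_component_measurable)

lemma ennreal_lr: "ennreal (lr I \<mu> x) = (\<Prod>j\<in>I. ennreal (tilt (\<mu> j) (x j)))"
  unfolding lr_def by (intro prod_ennreal[symmetric] less_imp_le tilt_pos)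

text \<open>Change of measure: the risks at different parameters become integrals under one common
  law.\<close>

lemma nn_integral_std_normals_shift:
  assumes "finite I" and [measurable]: "F \<in> borel_measurable (PiM I (\<lambda>_. std_normal))"
  shows "(\<integral>\<^sup>+x. F (\<lambda>j\<in>I. \<mu> j + x j) \<partial>PiM I (\<lambda>_. std_normal))
    = (\<integral>\<^sup>+x. F x * ennreal (lr I \<mu> x) \<partial>PiM I (\<lambda>_. std_normal))"
proof -
  have [measurable]: "(\<lambda>x. \<lambda>j\<in>I. \<mu> j + x j) \<in> PiM I (\<lambda>_. std_normal) \<rightarrow>\<^sub>M PiM I (\<lambda>_. std_normal)"
    by measurable
  have [measurable]: "(\<lambda>x. \<Prod>j\<in>I. ennreal (tilt (\<mu> j) (x j))) \<in> borel_measurable (PiM I (\<lambda>_. std_normal))"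
    unfolding ennreal_lr[symmetric] by measurable
  have "(\<integral>\<^sup>+x. F (\<lambda>j\<in>I. \<mu> j + x j) \<partial>PiM I (\<lambda>_. std_normal))
    = (\<integral>\<^sup>+x. F x \<partial>distr (PiM I (\<lambda>_. std_normal)) (PiM I (\<lambda>_. std_normal)) (\<lambda>x. \<lambda>j\<in>I. \<mu> j + x j))"
    by (rule nn_integral_distr[symmetric]) measurable
  also have "\<dots> = (\<integral>\<^sup>+x. (\<Prod>j\<in>I. ennreal (tilt (\<mu> j) (x j))) * F x \<partial>PiM I (\<lambda>_. std_normal))"
    unfolding distr_std_normals_shift[OF assms(1)] by (rule nn_integral_density) measurable
  finally show ?thesis by (simp add: ennreal_lr mult.commute)
qed

lemma nn_integral_lr:
  assumes "finite I"
  shows "(\<integral>\<^sup>+x. ennreal (lr I \<mu> x) \<partial>PiM I (\<lambda>_. std_normal)) = 1"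
proof -
  have "(\<integral>\<^sup>+x. ennreal (lr I \<mu> x) \<partial>PiM I (\<lambda>_. std_normal))
    = (\<Prod>j\<in>I. \<integral>\<^sup>+x. ennreal (tilt (\<mu> j) x) \<partial>std_normal)"
    unfolding ennreal_lr using assms
    by (intro std_normals.product_nn_integral_prod) auto
  then show ?thesis by (simp add: nn_integral_tilt)
qed

text \<open>The integral factors over coordinates into the one-dimensional tilt products. Averaged
  over pairs of shifts, it gives the second moment of the likelihood ratio of a mixture.\<close>

lemma nn_integral_lr_mult_lr:
  assumes "finite I"
  shows "(\<integral>\<^sup>+x. ennreal (lr I \<mu> x) * ennreal (lr I \<nu> x) \<partial>PiM I (\<lambda>_. std_normal))
    = ennreal (exp (\<Sum>j\<in>I. \<mu> j * \<nu> j))"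
proof -
  have "(\<integral>\<^sup>+x. ennreal (lr I \<mu> x) * ennreal (lr I \<nu> x) \<partial>PiM I (\<lambda>_. std_normal))
    = (\<integral>\<^sup>+x. (\<Prod>j\<in>I. ennreal (tilt (\<mu> j) (x j)) * ennreal (tilt (\<nu> j) (x j)))
        \<partial>PiM I (\<lambda>_. std_normal))"
    by (intro nn_integral_cong) (simp only: ennreal_lr prod.distrib)
  also have "\<dots> = (\<Prod>j\<in>I. \<integral>\<^sup>+x. ennreal (tilt (\<mu> j) x) * ennreal (tilt (\<nu> j) x) \<partial>std_normal)"
    by (rule std_normals.product_nn_integral_prod[OF assms]) measurable
  also have "\<dots> = ennreal (exp (\<Sum>j\<in>I. \<mu> j * \<nu> j))"
    unfolding nn_integral_tilt_mult_tilt exp_sum[OF assms] by (rule prod_ennreal) simp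
  finally show ?thesis .
qed

section \<open>Risk bound from testing zero against a mixture\<close>

text \<open>The risk at zero and the average risk over the mixture are each at most the supremum,
  whence the factor 2 in the denominator. \<open>K\<close> controls the second moment of the
  likelihood ratio of the mixture, one row of the matrix of pairs at a time.\<close>

lemma minimax_fuzzy_hypotheses:
  fixes \<theta> :: "'k \<Rightarrow> nat \<Rightarrow> real"
  assumes A: "finite A" "A \<noteq> {}" and \<theta>: "\<And>k. k \<in> A \<Longrightarrow> \<theta> k \<in> B0 d s" "\<And>k. k \<in> A \<Longrightarrow> lin d (\<theta> k) = L"
    and "\<sigma> > 0" "K \<ge> 0" and T: "T \<in> estimators d"
    and K: "\<And>k. k \<in> A \<Longrightarrow> (\<Sum>k'\<in>A. exp (\<Sum>j=1..d. \<theta> k j / \<sigma> * (\<theta> k' j / \<sigma>))) \<le> real (card A) * K"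
  shows "ennreal (L\<^sup>2 / (2 * (1 + K))) \<le> (SUP \<theta>\<in>B0 d s. mse \<sigma> d T \<theta>)"
proof -
  define I where "I = {1..d}"
  have I: "finite I" by (simp add: I_def)
  note mse_conv = mse_conv_std_normals[OF T, folded I_def]
  let ?P = "PiM I (\<lambda>_. std_normal)"
  define R where "R = (SUP \<theta>\<in>B0 d s. mse \<sigma> d T \<theta>)"
  define w where "w = 1 / real (card A)"
  have card: "card A > 0" using A by (simp add: card_gt_0_iff)
  have w: "w > 0" "real (card A) * w = 1" using card by (auto simp: w_def)
  have w_card: "of_nat (card A) * ennreal w = 1"
    using w by (simp add: ennreal_of_nat_eq_real_of_nat flip: ennreal_mult)
  define g where "g k = lr I (\<lambda>j. \<theta> k j / \<sigma>)" for k
  define f where "f x = (\<Sum>k\<in>A. w * g k x)" for x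
  \<comment> \<open>\<open>U\<close> reads the estimator as a function of the noise at parameter
    zero; the parameter \<open>\<theta> k\<close> then acts as the shift
    \<open>\<theta> k / \<sigma>\<close>.\<close>
  define U where "U x = T (\<lambda>j\<in>I. \<sigma> * x j)" for x
  have g0: "0 \<le> g k x" for k x by (simp add: g_def lr_nonneg)
  have f0: "0 \<le> f x" for x using w g0 by (auto simp: f_def intro!: sum_nonneg mult_nonneg_nonneg)
  have [measurable]: "g k \<in> borel_measurable ?P" for k by (simp add: g_def)
  have [measurable]: "f \<in> borel_measurable ?P" unfolding f_def[abs_def] by measurable
  have [measurable]: "T \<in> borel_measurable (Rd d)" using T by (simp add: estimators_def)
  have [measurable]: "U \<in> borel_measurable ?P"
  proof -
    have [measurable]: "(\<lambda>x. \<lambda>j\<in>I. \<sigma> * x j) \<in> ?P \<rightarrow>\<^sub>M Rd d" unfolding Rd_def I_def[symmetric] by measurable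
    show ?thesis unfolding U_def[abs_def] by measurable
  qed
  have ennreal_f: "ennreal (f x) = (\<Sum>k\<in>A. ennreal w * ennreal (g k x))" for x
  proof -
    have "ennreal (f x) = (\<Sum>k\<in>A. ennreal (w * g k x))"
      unfolding f_def using w g0 by (intro sum_ennreal[symmetric]) simp
    also have "\<dots> = (\<Sum>k\<in>A. ennreal w * ennreal (g k x))"
      using w g0 by (intro sum.cong refl ennreal_mult) simp_all
    finally show ?thesis .
  qed

  have null: "(\<integral>\<^sup>+x. ennreal ((U x)\<^sup>2) \<partial>?P) \<le> R"
  proof -
    let ?z = "\<lambda>j\<in>I. 0 :: real"
    have "lin d ?z = 0"
      unfolding lin_def I_def[symmetric] by (intro sum.neutral) simp
    moreover have "(\<lambda>j\<in>I. ?z j + \<sigma> * x j) = (\<lambda>j\<in>I. \<sigma> * x j)" for x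
      by (rule restrict_ext) simp
    ultimately have "(\<integral>\<^sup>+x. ennreal ((U x)\<^sup>2) \<partial>?P) = mse \<sigma> d T ?z"
      unfolding mse_conv U_def by (simp only: diff_zero)
    also have "?z \<in> B0 d s"
    proof -
      have "{j \<in> I. ?z j \<noteq> 0} = {}" by auto
      then have "l0_norm d ?z = 0" unfolding l0_norm_def I_def[symmetric] by (simp only: card.empty)
      then show ?thesis unfolding B0_def Rd_def I_def[symmetric] by (simp add: space_PiM)
    qed
    then have "mse \<sigma> d T ?z \<le> R" unfolding R_def by (rule SUP_upper)
    finally show ?thesis .
  qed
  have alt: "(\<integral>\<^sup>+x. ennreal ((U x - L)\<^sup>2) * ennreal (g k x) \<partial>?P) \<le> R" if "k \<in> A" for k
  proof -
    have "(\<integral>\<^sup>+x. ennreal ((U x - L)\<^sup>2) * ennreal (g k x) \<partial>?P)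
      = (\<integral>\<^sup>+x. ennreal ((U (\<lambda>j\<in>I. \<theta> k j / \<sigma> + x j) - L)\<^sup>2) \<partial>?P)"
      unfolding g_def by (rule nn_integral_std_normals_shift[OF I, symmetric]) measurable
    also have "\<dots> = mse \<sigma> d T (\<theta> k)"
      unfolding mse_conv U_def \<theta>(2)[OF that] using \<open>\<sigma> > 0\<close>
      by (simp add: distrib_left cong: restrict_cong)
    also have "\<dots> \<le> R" unfolding R_def using \<theta>(1)[OF that] by (rule SUP_upper)
    finally show ?thesis .
  qed
  have mix: "(\<integral>\<^sup>+x. ennreal ((U x - L)\<^sup>2) * ennreal (f x) \<partial>?P) \<le> R"
  proof -
    have "(\<integral>\<^sup>+x. ennreal ((U x - L)\<^sup>2) * ennreal (f x) \<partial>?P)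
      = (\<integral>\<^sup>+x. (\<Sum>k\<in>A. ennreal w * (ennreal ((U x - L)\<^sup>2) * ennreal (g k x))) \<partial>?P)"
      unfolding ennreal_f by (simp add: sum_distrib_left mult_ac)
    also have "\<dots> = (\<Sum>k\<in>A. ennreal w * (\<integral>\<^sup>+x. ennreal ((U x - L)\<^sup>2) * ennreal (g k x) \<partial>?P))"
      by (subst nn_integral_sum, measurable, intro sum.cong refl nn_integral_cmult) measurable
    also have "\<dots> \<le> (\<Sum>k\<in>A. ennreal w * R)"
      by (intro sum_mono mult_left_mono alt) auto
    also have "\<dots> = of_nat (card A) * ennreal w * R"
      by (simp add: mult_ac)
    finally show ?thesis by (simp add: w_card)
  qed
  have f1: "(\<integral>\<^sup>+x. ennreal (f x) \<partial>?P) = 1"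
  proof -
    have "(\<integral>\<^sup>+x. ennreal (f x) \<partial>?P) = (\<Sum>k\<in>A. ennreal w * (\<integral>\<^sup>+x. ennreal (g k x) \<partial>?P))"
      unfolding ennreal_f
      by (subst nn_integral_sum, measurable, intro sum.cong refl nn_integral_cmult) measurable
    also have "\<dots> = of_nat (card A) * ennreal w"
      by (simp add: g_def nn_integral_lr[OF I])
    finally show ?thesis by (simp add: w_card)
  qed
  \<comment> \<open>Expanded over pairs, the second moment is the average of exponentials of inner
    products.\<close>
  have f2: "(\<integral>\<^sup>+x. ennreal ((f x)\<^sup>2) \<partial>?P) \<le> ennreal K"
  proof -
    have "ennreal ((f x)\<^sup>2) = ennreal (f x) * ennreal (f x)" for x
      using f0 by (simp add: power2_eq_square ennreal_mult)
    then have "(\<integral>\<^sup>+x. ennreal ((f x)\<^sup>2) \<partial>?P)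
      = (\<integral>\<^sup>+x. (\<Sum>k\<in>A. \<Sum>k'\<in>A. ennreal (w * w) * (ennreal (g k x) * ennreal (g k' x))) \<partial>?P)"
      using w by (simp add: ennreal_f sum_product ennreal_mult' mult_ac)
    also have "\<dots> = (\<Sum>k\<in>A. \<Sum>k'\<in>A. ennreal (w * w) * (\<integral>\<^sup>+x. ennreal (g k x) * ennreal (g k' x) \<partial>?P))"
      by (subst nn_integral_sum, measurable, intro sum.cong refl, subst nn_integral_sum, measurable,
          intro sum.cong refl nn_integral_cmult) measurable
    also have "\<dots> = ennreal (\<Sum>k\<in>A. w * w * (\<Sum>k'\<in>A. exp (\<Sum>j\<in>I. \<theta> k j / \<sigma> * (\<theta> k' j / \<sigma>))))"
      unfolding g_def using w
      by (simp add: nn_integral_lr_mult_lr[OF I] sum_distrib_left sum_nonneg flip: ennreal_mult')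
    also have "\<dots> \<le> ennreal (\<Sum>k\<in>A. w * w * (real (card A) * K))"
      using w K[folded I_def] by (intro ennreal_leI sum_mono mult_left_mono) auto
    also have "(\<Sum>k\<in>A. w * w * (real (card A) * K)) = (real (card A) * w) * (real (card A) * w) * K"
      by simp
    finally show ?thesis by (simp add: w)
  qed

  \<comment> \<open>\<open>f / (1 + f) \<ge> 2 l f - l\<^sup>2 f (1 + f)\<close> for every \<open>l\<close>; this choice is optimal when \<open>E f\<^sup>2 = K\<close>.\<close>
  define l where "l = 1 / (1 + K)"
  have l: "l > 0" "l * (1 + K) = 1" using \<open>K \<ge> 0\<close> by (auto simp: l_def)
  have pt: "2 * l * L\<^sup>2 * f x \<le> (U x)\<^sup>2 + (U x - L)\<^sup>2 * f x + L\<^sup>2 * l\<^sup>2 * (f x + (f x)\<^sup>2)" for x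
  proof -
    let ?f = "f x" and ?u = "U x"
    \<comment> \<open>The first square vanishes at the minimiser \<open>u = L * f / (1 + f)\<close>.
      The second one accounts for replacing \<open>1 / (1 + f)\<close> by its tangent
      \<open>2 * l - l\<^sup>2 * (1 + f)\<close>, which makes the bound linear in \<open>f\<close>
      and \<open>f\<^sup>2\<close>.\<close>
    have "0 \<le> (?u * (1 + ?f) - L * ?f)\<^sup>2 + L\<^sup>2 * ?f * (1 - l * (1 + ?f))\<^sup>2"
      using f0[of x] by (intro add_nonneg_nonneg mult_nonneg_nonneg) auto
    also have "\<dots> = (1 + ?f) * (?u\<^sup>2 + (?u - L)\<^sup>2 * ?f + L\<^sup>2 * l\<^sup>2 * (?f + ?f\<^sup>2) - 2 * l * L\<^sup>2 * ?f)"
      by (simp add: power2_eq_square algebra_simps)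
    finally show ?thesis using f0[of x] by (simp add: zero_le_mult_iff)
  qed
  have "ennreal (2 * l * L\<^sup>2) = ennreal (2 * l * L\<^sup>2) * (\<integral>\<^sup>+x. ennreal (f x) \<partial>?P)"
    by (simp add: f1)
  also have "\<dots> = (\<integral>\<^sup>+x. ennreal (2 * l * L\<^sup>2 * f x) \<partial>?P)"
    using l by (subst nn_integral_cmult[symmetric]) (auto simp: ennreal_mult')
  also have "\<dots> \<le> (\<integral>\<^sup>+x. (ennreal ((U x)\<^sup>2) + ennreal ((U x - L)\<^sup>2) * ennreal (f x)) +
      ennreal (L\<^sup>2 * l\<^sup>2) * (ennreal (f x) + ennreal ((f x)\<^sup>2)) \<partial>?P)"
    using pt f0 by (intro nn_integral_mono) (simp add: ennreal_leI flip: ennreal_mult' ennreal_plus)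
  also have "\<dots> = ((\<integral>\<^sup>+x. ennreal ((U x)\<^sup>2) \<partial>?P) + (\<integral>\<^sup>+x. ennreal ((U x - L)\<^sup>2) * ennreal (f x) \<partial>?P)) +
      ennreal (L\<^sup>2 * l\<^sup>2) * ((\<integral>\<^sup>+x. ennreal (f x) \<partial>?P) + (\<integral>\<^sup>+x. ennreal ((f x)\<^sup>2) \<partial>?P))"
    by (simp add: nn_integral_add nn_integral_cmult)
  also have "\<dots> \<le> (R + R) + ennreal (L\<^sup>2 * l\<^sup>2) * (1 + ennreal K)"
    using null mix f1 f2 by (intro add_mono mult_left_mono) auto
  \<comment> \<open>Since \<open>l * (1 + K) = 1\<close>, the correction is exactly half of the left
    side.\<close>
  also have "ennreal (L\<^sup>2 * l\<^sup>2) * (1 + ennreal K) = ennreal (L\<^sup>2 * l * (l * (1 + K)))"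
    using \<open>K \<ge> 0\<close> l by (simp add: power2_eq_square mult_ac flip: ennreal_mult' ennreal_plus ennreal_1)
  also have "\<dots> = ennreal (l * L\<^sup>2)" by (simp add: l mult.commute)
  finally have main: "ennreal (2 * l * L\<^sup>2) \<le> R + R + ennreal (l * L\<^sup>2)" .
  show ?thesis
  \<comment> \<open>The term \<open>l * L\<^sup>2\<close> can be subtracted when the supremum is
    finite; an infinite supremum satisfies the bound trivially.\<close>
  proof (cases R)
    case (real r)
    have "R + R + ennreal (l * L\<^sup>2) = ennreal (r + r + l * L\<^sup>2)"
      using real l by (simp only: ennreal_plus add_nonneg_nonneg mult_nonneg_nonneg zero_le_power2 less_imp_le)
    then have "ennreal (2 * l * L\<^sup>2) \<le> ennreal (r + r + l * L\<^sup>2)"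
      using main by simp
    then have "l * L\<^sup>2 / 2 \<le> r" using real l by (subst (asm) ennreal_le_iff) auto
    then have "ennreal (l * L\<^sup>2 / 2) \<le> R" using real by (simp add: ennreal_leI)
    then show ?thesis by (simp add: l_def R_def mult.commute)
  next
    case top
    then show ?thesis unfolding R_def[symmetric] by simp
  qed
qed

section \<open>The block mixture and its second moment\<close>

text \<open>Rounding loses at most a factor 2: with \<open>m = d div s\<close> at least 1,
  \<open>d < (m + 1) * s \<le> 2 * m * s\<close>. Hence the relative increment
  \<open>x = d / (s\<^sup>2 * m)\<close> satisfies \<open>s * x \<le> 2\<close>, and
  \<open>(1 + x) ^ s \<le> exp (s * x)\<close>.\<close>

lemma mixture_second_moment_bound:
  assumes "1 \<le> s" "s \<le> d"
  shows "real (d div s) > 0" "(real (d div s) + real d / (real s)\<^sup>2) ^ s \<le> real (d div s) ^ s * exp 2"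
proof -
  define m where "m = d div s"
  have m: "m \<ge> 1" using assms by (simp add: m_def div_greater_zero_iff Suc_le_eq)
  then show "real (d div s) > 0" by (simp add: m_def)
  have "d < (m + 1) * s" using assms by (simp add: m_def dividend_less_div_times add.commute)
  also have "\<dots> \<le> 2 * m * s" using m by (intro mult_right_mono) auto
  finally have "real d \<le> real (2 * m * s)" by (simp only: of_nat_le_iff)
  then have d: "real d \<le> 2 * real m * real s" by simp
  define x where "x = real d / (real s)\<^sup>2 / real m"
  have x: "0 \<le> x" "real s * x \<le> 2"
    using d m assms by (auto simp: x_def field_simps power2_eq_square)
  have "(real m + real d / (real s)\<^sup>2) ^ s = real m ^ s * (1 + x) ^ s"
    using m by (simp add: x_def field_simps flip: power_mult_distrib)
  also have "\<dots> \<le> real m ^ s * exp x ^ s"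
    using x by (intro mult_left_mono power_mono) auto
  also have "\<dots> \<le> real m ^ s * exp 2"
    using x by (intro mult_left_mono) (auto simp flip: exp_of_nat_mult)
  finally show "(real (d div s) + real d / (real s)\<^sup>2) ^ s \<le> real (d div s) ^ s * exp 2"
    by (simp add: m_def)
qed

text \<open>
  The mixture: \<open>{1..d}\<close> contains \<open>s\<close> consecutive blocks of length \<open>d div s\<close>, and \<open>\<theta>\<close> equals \<open>\<sigma> \<alpha>\<close> at one
  position \<open>\<kappa> b\<close> of each block \<open>b\<close> and \<open>0\<close> elsewhere. With independent uniform positions the overlap
  of two supports is binomial instead of hypergeometric.
\<close>

lemma risk_lower_bound:
  assumes sd: "1 \<le> s" "s \<le> d" and "\<sigma> > 0" and T: "T \<in> estimators d"
  shows "ennreal (1 / (2 * (1 + exp 2)) * \<sigma>\<^sup>2 * (real s)\<^sup>2 * ln (1 + real d / (real s)\<^sup>2))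
    \<le> (SUP \<theta>\<in>B0 d s. mse \<sigma> d T \<theta>)"
proof -
  define m where "m = d div s"
  \<comment> \<open>With this amplitude each block in which two supports coincide contributes the
    factor \<open>1 + d / s\<^sup>2\<close> to the second moment.\<close>
  define \<alpha> where "\<alpha> = sqrt (ln (1 + real d / (real s)\<^sup>2))"
  have \<alpha>2: "\<alpha>\<^sup>2 = ln (1 + real d / (real s)\<^sup>2)" by (simp add: \<alpha>_def)
  have "0 < 1 + real d / (real s)\<^sup>2" by (simp add: add_pos_nonneg)
  then have exp_\<alpha>2: "exp (\<alpha>\<^sup>2) = 1 + real d / (real s)\<^sup>2" by (simp add: \<alpha>2)
  have m: "m \<ge> 1" using mixture_second_moment_bound(1)[OF sd] by (simp add: m_def)
  define A where "A = ({..<s} \<rightarrow>\<^sub>E {..<m})"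
  \<comment> \<open>Blocks and positions are counted from 0 but coordinates from 1, hence the final
    \<open>+ 1\<close>.\<close>
  define e where "e b k = b * m + k + 1" for b k
  define S where "S \<kappa> = (\<lambda>b. e b (\<kappa> b)) ` {..<s}" for \<kappa>
  define \<theta> where "\<theta> \<kappa> = (\<lambda>j\<in>{1..d}. if j \<in> S \<kappa> then \<sigma> * \<alpha> else 0)" for \<kappa>
  have A: "\<kappa> b < m" if "\<kappa> \<in> A" "b < s" for \<kappa> b
    using that by (auto simp: A_def PiE_iff)
  have e_eq: "b = b' \<and> k = k'" if "e b k = e b' k'" "k < m" "k' < m" for b b' k k'
  \<comment> \<open>Block and position are recovered as quotient and remainder modulo
    \<open>m\<close>.\<close>
  proof -
    from that have eq: "b * m + k = b' * m + k'" by (simp add: e_def)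
    from arg_cong[OF eq, of "\<lambda>n. n div m"] arg_cong[OF eq, of "\<lambda>n. n mod m"] that m show ?thesis by simp
  qed
  have e_in: "e b k \<in> {1..d}" if "b < s" "k < m" for b k
  proof -
    have "e b k \<le> (b + 1) * m" using that by (simp add: e_def)
    also have "\<dots> \<le> s * m" using that by (intro mult_right_mono) auto
    also have "\<dots> \<le> d" by (simp add: m_def)
    finally show ?thesis by (simp add: e_def)
  qed
  have inj: "inj_on (\<lambda>b. e b (\<kappa> b)) {..<s}" if "\<kappa> \<in> A" for \<kappa>
  proof (rule inj_onI)
    fix b b' assume "b \<in> {..<s}" "b' \<in> {..<s}" "e b (\<kappa> b) = e b' (\<kappa> b')"
    then show "b = b'" using e_eq[of b "\<kappa> b" b' "\<kappa> b'"] A[OF that] by simp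
  qed
  have mem_S: "e b k \<in> S \<kappa> \<longleftrightarrow> k = \<kappa> b" if "\<kappa> \<in> A" "b < s" "k < m" for \<kappa> b k
  proof
    assume "e b k \<in> S \<kappa>"
    then obtain b' where "b' < s" "e b k = e b' (\<kappa> b')" by (auto simp: S_def)
    then show "k = \<kappa> b" using e_eq[of b k b' "\<kappa> b'"] A[OF that(1)] that(3) by simp
  next
    assume "k = \<kappa> b"
    then show "e b k \<in> S \<kappa>" using that(2) by (simp add: S_def)
  qed
  have S_sub: "S \<kappa> \<subseteq> {1..d}" if "\<kappa> \<in> A" for \<kappa>
    using A[OF that] e_in by (auto simp: S_def)
  \<comment> \<open>Used with \<open>h = 1\<close> for the value of the functional and with
    \<open>h\<close> built from a second member of the mixture for inner products.\<close>
  have sum_S: "(\<Sum>j=1..d. \<theta> \<kappa> j * h j) = (\<Sum>b<s. \<sigma> * \<alpha> * h (e b (\<kappa> b)))" if "\<kappa> \<in> A" for \<kappa> h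
  proof -
    have "(\<Sum>j=1..d. \<theta> \<kappa> j * h j) = (\<Sum>j\<in>S \<kappa>. \<sigma> * \<alpha> * h j)"
      using S_sub[OF that] by (intro sum.mono_neutral_cong_right) (auto simp: \<theta>_def)
    also have "\<dots> = (\<Sum>b<s. \<sigma> * \<alpha> * h (e b (\<kappa> b)))"
      unfolding S_def by (simp add: sum.reindex[OF inj[OF that]])
    finally show ?thesis .
  qed
  have "ennreal ((real s * (\<sigma> * \<alpha>))\<^sup>2 / (2 * (1 + exp 2))) \<le> (SUP \<theta>\<in>B0 d s. mse \<sigma> d T \<theta>)"
  proof (rule minimax_fuzzy_hypotheses[where A = A and \<theta> = \<theta>])
    show "finite A" by (auto simp: A_def intro!: finite_PiE)
    show "A \<noteq> {}" using m by (auto simp: A_def PiE_eq_empty_iff lessThan_empty_iff)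
  next
    fix \<kappa> assume \<kappa>: "\<kappa> \<in> A"
    have "{j \<in> {1..d}. \<theta> \<kappa> j \<noteq> 0} \<subseteq> S \<kappa>" by (auto simp: \<theta>_def)
    then have "card {j \<in> {1..d}. \<theta> \<kappa> j \<noteq> 0} \<le> card (S \<kappa>)"
      by (intro card_mono) (auto simp: S_def)
    also have "\<dots> \<le> s" unfolding S_def using card_image_le[of "{..<s}"] by simp
    finally show "\<theta> \<kappa> \<in> B0 d s"
      by (simp add: B0_def l0_norm_def Rd_def space_PiM \<theta>_def)
    show "lin d (\<theta> \<kappa>) = real s * (\<sigma> * \<alpha>)"
      using sum_S[OF \<kappa>, of "\<lambda>_. 1"] by (simp add: lin_def)
    have "(\<Sum>j=1..d. \<theta> \<kappa> j / \<sigma> * (\<theta> \<kappa>' j / \<sigma>)) = (\<Sum>b<s. if \<kappa>' b = \<kappa> b then \<alpha>\<^sup>2 else 0)"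
      if \<kappa>': "\<kappa>' \<in> A" for \<kappa>'
    proof -
      have "(\<Sum>j=1..d. \<theta> \<kappa> j / \<sigma> * (\<theta> \<kappa>' j / \<sigma>)) = (\<Sum>b<s. \<sigma> * \<alpha> * (\<theta> \<kappa>' (e b (\<kappa> b)) / \<sigma>\<^sup>2))"
        using sum_S[OF \<kappa>, of "\<lambda>j. \<theta> \<kappa>' j / \<sigma>\<^sup>2"] by (simp add: power2_eq_square)
      also have "\<dots> = (\<Sum>b<s. if \<kappa>' b = \<kappa> b then \<alpha>\<^sup>2 else 0)"
      proof (rule sum.cong)
        fix b assume "b \<in> {..<s}"
        then have "\<theta> \<kappa>' (e b (\<kappa> b)) = (if \<kappa>' b = \<kappa> b then \<sigma> * \<alpha> else 0)"
          using e_in[of b "\<kappa> b"] A[OF \<kappa>, of b] mem_S[OF \<kappa>', of b "\<kappa> b"] by (auto simp: \<theta>_def)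
        then show "\<sigma> * \<alpha> * (\<theta> \<kappa>' (e b (\<kappa> b)) / \<sigma>\<^sup>2) = (if \<kappa>' b = \<kappa> b then \<alpha>\<^sup>2 else 0)"
          using \<open>\<sigma> > 0\<close> by (simp add: power2_eq_square)
      qed simp
      finally show ?thesis .
    qed
    then have "(\<Sum>\<kappa>'\<in>A. exp (\<Sum>j=1..d. \<theta> \<kappa> j / \<sigma> * (\<theta> \<kappa>' j / \<sigma>)))
      = (\<Sum>\<kappa>'\<in>A. \<Prod>b<s. if \<kappa>' b = \<kappa> b then exp (\<alpha>\<^sup>2) else 1)"
      by (intro sum.cong refl) (simp add: exp_sum if_distrib[of exp] cong: if_cong)
    \<comment> \<open>Summing over all choice functions factors over the blocks; this is the
      independence of the positions.\<close>
    also have "\<dots> = (\<Prod>b<s. \<Sum>k<m. if k = \<kappa> b then exp (\<alpha>\<^sup>2) else 1)"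
      unfolding A_def by (rule prod_sum_PiE[symmetric]) auto
    also have "\<dots> = (\<Prod>b<s. real m + real d / (real s)\<^sup>2)"
    proof (rule prod.cong)
      fix b assume "b \<in> {..<s}"
      then have "\<kappa> b \<in> {..<m}" using A[OF \<kappa>] by simp
      \<comment> \<open>Exactly one of the \<open>m\<close> positions coincides with
        \<open>\<kappa> b\<close> and contributes \<open>1 + d / s\<^sup>2\<close>; each of the
        others contributes 1.\<close>
      then have "(\<Sum>k<m. if k = \<kappa> b then exp (\<alpha>\<^sup>2) else 1) = exp (\<alpha>\<^sup>2) + (\<Sum>k\<in>{..<m}-{\<kappa> b}. 1)"
        by (subst sum.remove[of _ "\<kappa> b"]) (auto intro!: sum.cong)
      also have "\<dots> = real m + real d / (real s)\<^sup>2"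
        using \<open>\<kappa> b \<in> {..<m}\<close> m by (simp add: exp_\<alpha>2 of_nat_diff)
      finally show "(\<Sum>k<m. if k = \<kappa> b then exp (\<alpha>\<^sup>2) else 1) = real m + real d / (real s)\<^sup>2" .
    qed simp
    also have "\<dots> \<le> real (card A) * exp 2"
      using mixture_second_moment_bound(2)[OF sd] by (simp add: A_def card_PiE m_def)
    finally show "(\<Sum>\<kappa>'\<in>A. exp (\<Sum>j=1..d. \<theta> \<kappa> j / \<sigma> * (\<theta> \<kappa>' j / \<sigma>))) \<le> real (card A) * exp 2" .
  qed (use \<open>\<sigma> > 0\<close> T in auto)
  also have "(real s * (\<sigma> * \<alpha>))\<^sup>2 / (2 * (1 + exp 2))
      = 1 / (2 * (1 + exp 2)) * \<sigma>\<^sup>2 * (real s)\<^sup>2 * ln (1 + real d / (real s)\<^sup>2)"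
    by (simp add: power_mult_distrib \<alpha>2)
  finally show ?thesis .
qed

theorem theorem1:
  shows "\<exists>c C :: real. c > 0 \<and> C > 0 \<and>
    (\<forall>(s::nat) (d::nat) (\<sigma>::real). 1 \<le> s \<and> s \<le> d \<and> \<sigma> > 0 \<longrightarrow>
      (SUP \<theta>\<in>B0 d s. mse \<sigma> d (L_hat \<sigma> d s) \<theta>)
        \<le> ennreal (C * \<sigma>\<^sup>2 * (real s)\<^sup>2 * ln (1 + real d / (real s)\<^sup>2)) \<and>
      (INF T\<in>estimators d. SUP \<theta>\<in>B0 d s. mse \<sigma> d T \<theta>)
        \<ge> ennreal (c * \<sigma>\<^sup>2 * (real s)\<^sup>2 * ln (1 + real d / (real s)\<^sup>2)))"
proof -
  \<comment> \<open>The case split of \<open>L_hat\<close> at \<open>sqrt d\<close> separates the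
    two regimes, which share the constant 32.\<close>
  have upper: "(SUP \<theta>\<in>B0 d s. mse \<sigma> d (L_hat \<sigma> d s) \<theta>)
      \<le> ennreal (32 * \<sigma>\<^sup>2 * (real s)\<^sup>2 * ln (1 + real d / (real s)\<^sup>2))"
    if "1 \<le> s" "\<sigma> > 0" for s d :: nat and \<sigma> :: real
  proof (rule SUP_least)
    fix \<theta> assume "\<theta> \<in> B0 d s"
    then have "l0_norm d \<theta> \<le> s" by (simp add: B0_def)
    then show "mse \<sigma> d (L_hat \<sigma> d s) \<theta>
        \<le> ennreal (32 * \<sigma>\<^sup>2 * (real s)\<^sup>2 * ln (1 + real d / (real s)\<^sup>2))"
      using that mse_L_hat_dense_le[of \<sigma> d s \<theta>] mse_L_hat_sparse_le[of \<sigma> s d \<theta>]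
      by (cases "real s < sqrt (real d)") auto
  qed
  \<comment> \<open>The constant is that of the mixture bound with \<open>K = exp 2\<close>; it is
    the same for every estimator, so it passes to the infimum.\<close>
  have lower: "ennreal (1 / (2 * (1 + exp 2)) * \<sigma>\<^sup>2 * (real s)\<^sup>2 * ln (1 + real d / (real s)\<^sup>2))
      \<le> (INF T\<in>estimators d. SUP \<theta>\<in>B0 d s. mse \<sigma> d T \<theta>)"
    if "1 \<le> s" "s \<le> d" "\<sigma> > 0" for s d :: nat and \<sigma> :: real
    by (rule INF_greatest) (rule risk_lower_bound[OF that])
  have c: "0 < 1 / (2 * (1 + exp 2 :: real))"
    by (simp add: add_pos_pos)
  show ?thesis
  proof (rule exI[of _ "1 / (2 * (1 + exp 2))"], rule exI[of _ 32], intro conjI allI impI)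
    fix s d :: nat and \<sigma> :: real
    assume "1 \<le> s \<and> s \<le> d \<and> \<sigma> > 0"
    then have *: "1 \<le> s" "s \<le> d" "\<sigma> > 0" by simp_all
    show "(SUP \<theta>\<in>B0 d s. mse \<sigma> d (L_hat \<sigma> d s) \<theta>)
        \<le> ennreal (32 * \<sigma>\<^sup>2 * (real s)\<^sup>2 * ln (1 + real d / (real s)\<^sup>2))"
      by (rule upper[OF *(1,3)])
    show "ennreal (1 / (2 * (1 + exp 2)) * \<sigma>\<^sup>2 * (real s)\<^sup>2 * ln (1 + real d / (real s)\<^sup>2))
        \<le> (INF T\<in>estimators d. SUP \<theta>\<in>B0 d s. mse \<sigma> d T \<theta>)"
      by (rule lower[OF *])
  qed (use c in simp_all)
qed

end
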